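(* Let $X$ be a Noetherian topological space, let $U\subseteq X$ be an open subset, and let $\Phi:U\longrightarrow X$ be a continuous map. Let $x\in X$ be such that $\Phi^n(x)\in U$ for each nonnegative integer $n$. Then for each closed set $Y\subseteq X$, the set $S:=\{n\in\mathbb{N}\colon \Phi^n(x)\in Y\}$ is a union of at most finitely many arithmetic progressions along with a set of Banach density zero.
   Context: A topological space is Noetherian if it has no infinite strictly descending chain of closed subsets. $\Phi^n$ denotes the $n$-th iterate (defined at $x$ by hypothesis). An arithmetic progression is a set $\{an+b\colon n\in\mathbb{N}\}$ with $a,b\in\mathbb{N}$; the ratio $a$ is allowed to be $0$. For $S\subseteq\mathbb{N}$, the Banach density is $\delta(S):=\limsup_{|I|\to\infty}\frac{|S\cap I|}{|I|}$, the $\limsup$ taken over intervals $I$ of natural numbers; $S$ has Banach density zero if $\delta(S)=0$. *)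

theory Defs
  imports "HOL-Analysis.Analysis"
begin

definition noetherian_space :: "'a topology \<Rightarrow> bool" where
  "noetherian_space X \<longleftrightarrow>
     \<not> (\<exists>C :: nat \<Rightarrow> 'a set. (\<forall>n. closedin X (C n)) \<and> (\<forall>n. C (Suc n) \<subset> C n))"

(* The ratio a may be 0, in which case the progression is the singleton {b}. *)
definition arithmetic_progression :: "nat set \<Rightarrow> bool" where
  "arithmetic_progression A \<longleftrightarrow> (\<exists>a b :: nat. A = {a * n + b | n. True})"

(* The filter "|I| tends to infinity" on the finite intervals I of natural numbers. *)
definition large_intervals :: "nat set filter" where
  "large_intervals = inf (filtercomap card at_top) (principal {I. \<exists>m n. I = {m..<n}})"

(* The limsup is taken in ereal, so that it always exists; its value lies in [0, 1]. *)
definition banach_density :: "nat set \<Rightarrow> ereal" where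
  "banach_density S =
     Limsup large_intervals (\<lambda>I. ereal (real (card (S \<inter> I)) / real (card I)))"

end

(* Pulling back along the orbit n \<mapsto> \<Phi>^n(x) turns the closed sets of X into a family of subsets of the naturals
   that is closed under intersections and under S \<mapsto> S - 1 = {n. n + 1 \<in> S}, and that satisfies the descending
   chain condition. Let S be a minimal member that is not of the asserted form. As S has positive Banach
   density, so has S \<inter> (S - k) for some k > 0. If S + k is contained in S, then S is a finite union of
   progressions of ratio k. Otherwise S \<inter> (S - k) is a proper subset of S, hence of the asserted form, and S
   contains a progression {a n + b} with a > 0. Let E c denote the closure of {a n + c}. By minimality S is
   contained in some E i with i < a, and one may take b > i. With d = b - i one gets E (i + d) \<subseteq> S \<subseteq> E i;
   shifting this repeatedly gives E (i + a d) \<subseteq> E (i + d), so S + a d \<subseteq> E (i + a d) \<subseteq> S and S is once more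
   a finite union of progressions. *)

theory Submission imports Defs begin

section \<open>Sets of Banach density zero\<close>

text \<open>With truncated subtraction \<open>card {m..<n} = n - m\<close> holds even for
  \<open>n < m\<close>, where the interval is empty, so a bound on the cardinality is a bound on
  \<open>n - m\<close>.\<close>

lemma eventually_large_intervals:
  "eventually P large_intervals \<longleftrightarrow> (\<exists>N. \<forall>m n. N \<le> n - m \<longrightarrow> P {m..<n})"
  unfolding large_intervals_def eventually_inf_principal eventually_filtercomap eventually_at_top_linorder
proof safe
  fix Q N
  assume "\<forall>n\<ge>N. Q n" and "\<forall>I. Q (card I) \<longrightarrow> I \<in> {I. \<exists>m n. I = {m..<n}} \<longrightarrow> P I"
  then have "P {m..<n}" if "N \<le> n - m" for m n
    using that by (metis (mono_tags, lifting) card_atLeastLessThan mem_Collect_eq)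
  then show "\<exists>N. \<forall>m n. N \<le> n - m \<longrightarrow> P {m..<n}"
    by blast
next
  fix N :: nat
  assume "\<forall>m n. N \<le> n - m \<longrightarrow> P {m..<n}"
  then show "\<exists>Q. (\<exists>N. \<forall>n\<ge>N. Q n) \<and> (\<forall>I. Q (card I) \<longrightarrow> I \<in> {I. \<exists>m n. I = {m..<n}} \<longrightarrow> P I)"
    by (intro exI[of _ "\<lambda>n. N \<le> n"]) auto
qed

lemma large_intervals_neq_bot: "large_intervals \<noteq> bot"
proof
  assume "large_intervals = bot"
  then obtain N :: nat where "\<And>m n. \<not> N \<le> n - m"
    unfolding trivial_limit_def eventually_large_intervals by blast
  from this[of N 0] show False by simp
qed

text \<open>Density zero as a real limit: estimates stay in the reals, and the \<open>ereal\<close>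
  limsup reappears only in the passage to \<open>banach_density\<close>.\<close>

definition null_density :: "nat set \<Rightarrow> bool" where
  "null_density S \<longleftrightarrow> ((\<lambda>I. real (card (S \<inter> I)) / real (card I)) \<longlongrightarrow> 0) large_intervals"

lemma null_density_imp_banach_density:
  assumes "null_density S"
  shows "banach_density S = 0"
  unfolding banach_density_def
  by (rule lim_imp_Limsup[OF large_intervals_neq_bot])
     (use assms in \<open>simp add: null_density_def zero_ereal_def\<close>)

lemma null_density_iff:
  "null_density S \<longleftrightarrow>
     (\<forall>e>0. \<exists>N. \<forall>m n. N \<le> n - m \<longrightarrow> real (card (S \<inter> {m..<n})) \<le> e * real (n - m))"
proof safe
  fix e :: real
  assume S: "null_density S" and e: "e > 0"
  then have "eventually (\<lambda>I. real (card (S \<inter> I)) / real (card I) < e) large_intervals"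
    unfolding null_density_def by (auto dest: order_tendstoD(2))
  then obtain N where N: "\<And>m n. N \<le> n - m \<Longrightarrow> real (card (S \<inter> {m..<n})) / real (n - m) < e"
    unfolding eventually_large_intervals by auto
  \<comment> \<open>\<open>Suc N\<close> makes the interval nonempty, so that multiplying by its
    length undoes the division; in HOL the quotient for an empty interval is 0.\<close>
  have "real (card (S \<inter> {m..<n})) \<le> e * real (n - m)" if "Suc N \<le> n - m" for m n
    using N[of n m] that by (simp add: divide_less_eq split: if_splits)
  then show "\<exists>N. \<forall>m n. N \<le> n - m \<longrightarrow> real (card (S \<inter> {m..<n})) \<le> e * real (n - m)"
    by blast
next
  assume *: "\<forall>e>0. \<exists>N. \<forall>m n. N \<le> n - m \<longrightarrow> real (card (S \<inter> {m..<n})) \<le> e * real (n - m)"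
  show "null_density S"
    unfolding null_density_def
  proof (rule tendstoI)
    fix e :: real assume "e > 0"
    then obtain N where N: "\<And>m n. N \<le> n - m \<Longrightarrow> real (card (S \<inter> {m..<n})) \<le> e / 2 * real (n - m)"
      using * by (metis half_gt_zero)
    have "real (card (S \<inter> {m..<n})) / real (n - m) < e" if "Suc N \<le> n - m" for m n
    proof -
      have pos: "real (n - m) > 0"
        using that by simp
      then have "e / 2 * real (n - m) < e * real (n - m)"
        using \<open>e > 0\<close> by simp
      then show ?thesis
        using N[of n m] that pos by (simp add: divide_less_eq)
    qed
    then show "eventually (\<lambda>I. dist (real (card (S \<inter> I)) / real (card I)) 0 < e) large_intervals"
      unfolding eventually_large_intervals by (intro exI[of _ "Suc N"]) (simp add: dist_real_def)
  qed
qed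

lemma null_density_Un:
  assumes "null_density S" "null_density T"
  shows "null_density (S \<union> T)"
  unfolding null_density_iff
proof safe
  fix e :: real assume "e > 0"
  then obtain M N where
    M: "\<And>m n. M \<le> n - m \<Longrightarrow> real (card (S \<inter> {m..<n})) \<le> e / 2 * real (n - m)" and
    N: "\<And>m n. N \<le> n - m \<Longrightarrow> real (card (T \<inter> {m..<n})) \<le> e / 2 * real (n - m)"
    using assms unfolding null_density_iff by (metis half_gt_zero)
  have "real (card ((S \<union> T) \<inter> {m..<n})) \<le> e * real (n - m)" if "max M N \<le> n - m" for m n
  proof -
    have "card ((S \<union> T) \<inter> {m..<n}) \<le> card (S \<inter> {m..<n}) + card (T \<inter> {m..<n})"
      unfolding Int_Un_distrib2 by (rule card_Un_le)
    then have "real (card ((S \<union> T) \<inter> {m..<n})) \<le> real (card (S \<inter> {m..<n})) + real (card (T \<inter> {m..<n}))"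
      by linarith
    with M[of n m] N[of n m] that show ?thesis by simp
  qed
  then show "\<exists>N. \<forall>m n. N \<le> n - m \<longrightarrow> real (card ((S \<union> T) \<inter> {m..<n})) \<le> e * real (n - m)"
    by blast
qed

lemma null_density_finite:
  assumes "finite S"
  shows "null_density S"
  unfolding null_density_iff
proof safe
  fix e :: real assume e: "e > 0"
  obtain N :: nat where N: "real (card S) / e \<le> real N"
    using real_arch_simple by blast
  have "real (card (S \<inter> {m..<n})) \<le> e * real (n - m)" if "N \<le> n - m" for m n
  proof -
    have "real (card (S \<inter> {m..<n})) \<le> real (card S)"
      using assms by (simp add: card_mono)
    also have "\<dots> \<le> e * real N"
      using N e by (simp add: divide_le_eq mult.commute)
    also have "\<dots> \<le> e * real (n - m)"
      using that e by simp
    finally show ?thesis .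
  qed
  then show "\<exists>N. \<forall>m n. N \<le> n - m \<longrightarrow> real (card (S \<inter> {m..<n})) \<le> e * real (n - m)"
    by blast
qed

lemma null_density_UN:
  assumes "finite I" "\<And>i. i \<in> I \<Longrightarrow> null_density (A i)"
  shows "null_density (\<Union>i\<in>I. A i)"
  using assms
proof (induction I)
  case empty
  then show ?case by (simp add: null_density_finite)
next
  case (insert i I)
  then show ?case by (simp add: null_density_Un)
qed

text \<open>Cut the interval into blocks of length \<open>L\<close> starting at \<open>m\<close>:
  spaced elements fall into different blocks, and at most \<open>(n - m) div L + 1\<close> blocks
  occur.\<close>

lemma card_spaced_le:
  fixes A :: "nat set"
  assumes "L > 0" and spaced: "\<And>s t. s \<in> A \<Longrightarrow> t \<in> A \<Longrightarrow> s < t \<Longrightarrow> L \<le> t - s"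
  shows "card (A \<inter> {m..<n}) \<le> (n - m) div L + 1"
proof -
  have less: "(s - m) div L < (t - m) div L" if "s \<in> A" "t \<in> A" "m \<le> s" "s < t" for s t
  proof -
    have "(s - m) + L \<le> t - m"
      using spaced[OF that(1,2,4)] that by linarith
    then have "((s - m) + L) div L \<le> (t - m) div L"
      by (rule div_le_mono)
    then show ?thesis using \<open>L > 0\<close> by simp
  qed
  have "inj_on (\<lambda>s. (s - m) div L) (A \<inter> {m..<n})"
    by (rule linorder_inj_onI) (use less in fastforce)+
  moreover have "(\<lambda>s. (s - m) div L) ` (A \<inter> {m..<n}) \<subseteq> {..(n - m) div L}"
    by (auto intro!: div_le_mono)
  ultimately have "card (A \<inter> {m..<n}) \<le> card {..(n - m) div L}"
    by (intro card_inj_on_le) auto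
  then show ?thesis by simp
qed

text \<open>A recurrence principle, used in contrapositive form. The elements of \<open>S\<close>
  followed by another within distance less than \<open>L\<close> form a finite union of null sets;
  the remaining ones are \<open>L\<close>-spaced and contribute density at most
  \<open>1 / L\<close>.\<close>

lemma null_density_if_returns_null:
  assumes returns: "\<And>k. k > 0 \<Longrightarrow> null_density {n \<in> S. n + k \<in> S}"
  shows "null_density S"
  unfolding null_density_iff
proof safe
  fix e :: real assume e: "e > 0"
  \<comment> \<open>The error is split into thirds: one for the early returns \<open>T\<close>, one
    for the quotient by \<open>L\<close>, and one for the additive 1, which \<open>N\<close> below
    absorbs.\<close>
  obtain L :: nat where L: "L > 0" "1 / real L < e / 3"
    using real_arch_inverse[of "e / 3"] e by (auto simp: inverse_eq_divide)
  define T where "T = (\<Union>k\<in>{0<..<L}. {n \<in> S. n + k \<in> S})"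
  have "null_density T"
    unfolding T_def by (intro null_density_UN) (auto intro: returns)
  then obtain M where M: "\<And>m n. M \<le> n - m \<Longrightarrow> real (card (T \<inter> {m..<n})) \<le> e / 3 * real (n - m)"
    using e unfolding null_density_iff by (metis divide_pos_pos zero_less_numeral)
  obtain N :: nat where N: "3 / e \<le> real N"
    using real_arch_simple by blast
  have spaced: "L \<le> t - s" if "s \<in> S - T" "t \<in> S - T" "s < t" for s t
  proof (rule ccontr)
    assume "\<not> L \<le> t - s"
    then have "s \<in> T"
      unfolding T_def using that by (auto intro!: bexI[of _ "t - s"])
    then show False using that by simp
  qed
  have "real (card (S \<inter> {m..<n})) \<le> e * real (n - m)" if "max M N \<le> n - m" for m n
  proof -
    have "card (S \<inter> {m..<n}) \<le> card (T \<inter> {m..<n} \<union> (S - T) \<inter> {m..<n})"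
      by (intro card_mono) auto
    also have "\<dots> \<le> card (T \<inter> {m..<n}) + card ((S - T) \<inter> {m..<n})"
      by (rule card_Un_le)
    finally have "real (card (S \<inter> {m..<n})) \<le> real (card (T \<inter> {m..<n})) + real (card ((S - T) \<inter> {m..<n}))"
      by linarith
    moreover have "real (card ((S - T) \<inter> {m..<n})) \<le> e / 3 * real (n - m) + e / 3 * real (n - m)"
    proof -
      have "real (card ((S - T) \<inter> {m..<n})) \<le> real ((n - m) div L) + 1"
        using card_spaced_le[OF L(1) spaced] by (metis of_nat_1 of_nat_add of_nat_mono)
      also have "real ((n - m) div L) \<le> real (n - m) / real L"
        by (rule of_nat_div_le_of_nat)
      also have "\<dots> \<le> e / 3 * real (n - m)"
        using mult_right_mono[of "1 / real L" "e / 3" "real (n - m)"] L by simp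
      also have "1 \<le> e / 3 * real (n - m)"
      proof -
        have "3 / e \<le> real (n - m)"
          using N that by linarith
        then have "e / 3 * (3 / e) \<le> e / 3 * real (n - m)"
          by (rule mult_left_mono) (use e in simp)
        moreover have "e / 3 * (3 / e) = 1"
          using e by simp
        ultimately show ?thesis
          by (simp only:)
      qed
      finally show ?thesis by simp
    qed
    ultimately show ?thesis using M[of n m] that by simp
  qed
  then show "\<exists>N. \<forall>m n. N \<le> n - m \<longrightarrow> real (card (S \<inter> {m..<n})) \<le> e * real (n - m)"
    by blast
qed

section \<open>Finite unions of arithmetic progressions up to density zero\<close>

definition ap_union_mod_null :: "nat set \<Rightarrow> bool" where
  "ap_union_mod_null S \<longleftrightarrow>
     (\<exists>P Z. finite P \<and> (\<forall>A\<in>P. arithmetic_progression A) \<and> null_density Z \<and> S = \<Union>P \<union> Z)"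

lemma null_density_imp_ap_union_mod_null: "null_density S \<Longrightarrow> ap_union_mod_null S"
  unfolding ap_union_mod_null_def by (rule exI[of _ "{}"]) auto

lemma ap_union_mod_null_Un:
  assumes "ap_union_mod_null S" "ap_union_mod_null T"
  shows "ap_union_mod_null (S \<union> T)"
proof -
  from assms obtain P Z Q W where
    "finite P" "\<forall>A\<in>P. arithmetic_progression A" "null_density Z" "S = \<Union>P \<union> Z"
    "finite Q" "\<forall>A\<in>Q. arithmetic_progression A" "null_density W" "T = \<Union>Q \<union> W"
    unfolding ap_union_mod_null_def by blast
  then show ?thesis
    unfolding ap_union_mod_null_def
    by (intro exI[of _ "P \<union> Q"] exI[of _ "Z \<union> W"]) (auto intro: null_density_Un)
qed

lemma ap_union_mod_null_UN:
  assumes "finite I" "\<And>i. i \<in> I \<Longrightarrow> ap_union_mod_null (A i)"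
  shows "ap_union_mod_null (\<Union>i\<in>I. A i)"
  using assms
proof (induction I)
  case empty
  then show ?case
    by (simp add: null_density_imp_ap_union_mod_null null_density_finite)
next
  case (insert i I)
  then show ?case by (simp add: ap_union_mod_null_Un)
qed

text \<open>In each residue class mod \<open>k\<close> that \<open>S\<close> meets, \<open>S\<close>
  consists of the least element there and everything above it in the class, which is one progression
  of ratio \<open>k\<close>. No null remainder is left.\<close>

lemma ap_union_mod_null_if_shift_invariant:
  assumes "k > 0" and inv: "\<And>s. s \<in> S \<Longrightarrow> s + k \<in> S"
  shows "ap_union_mod_null S"
proof -
  define R where "R = (\<lambda>s. s mod k) ` S"
  define l where "l i = (LEAST s. s \<in> S \<and> s mod k = i)" for i
  define A where "A i = {k * n + l i | n. True}" for i
  have l: "l i \<in> S" "l i mod k = i" if "i \<in> R" for i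
  proof -
    have "\<exists>s. s \<in> S \<and> s mod k = i"
      using that by (auto simp: R_def)
    from LeastI_ex[OF this] show "l i \<in> S" "l i mod k = i"
      unfolding l_def by auto
  qed
  have invs: "k * n + s \<in> S" if "s \<in> S" for n s
  proof (induction n)
    case (Suc n)
    then show ?case using inv[of "k * n + s"] by (simp add: ac_simps)
  qed (use that in simp)
  have "S = (\<Union>i\<in>R. A i)"
  proof safe
    fix s assume s: "s \<in> S"
    then have R: "s mod k \<in> R"
      by (simp add: R_def)
    have le: "l (s mod k) \<le> s"
      unfolding l_def by (rule Least_le) (use s in simp)
    have "k dvd s - l (s mod k)"
      using mod_eq_dvd_iff_nat[OF le, of k] l(2)[OF R] by simp
    then obtain n where "s - l (s mod k) = k * n" ..
    with le have "s = k * n + l (s mod k)"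
      by linarith
    with R show "s \<in> (\<Union>i\<in>R. A i)"
      unfolding A_def by blast
  qed (auto simp: A_def intro: invs l)
  moreover have "finite R"
    by (rule finite_subset[of _ "{..<k}"]) (use \<open>k > 0\<close> in \<open>auto simp: R_def\<close>)
  moreover have "\<forall>i. arithmetic_progression (A i)"
    unfolding arithmetic_progression_def A_def by blast
  ultimately show ?thesis
    unfolding ap_union_mod_null_def
    by (intro exI[of _ "A ` R"] exI[of _ "{}"]) (auto intro: null_density_finite)
qed

text \<open>If all progressions in the decomposition were finite, their union would be finite, hence
  null, and \<open>S\<close> with it. An infinite progression has nonzero ratio.\<close>

lemma ap_union_mod_null_contains_progression:
  assumes "ap_union_mod_null S" "\<not> null_density S"
  obtains a b where "a > 0" "\<And>n. a * n + b \<in> S"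
proof -
  from assms(1) obtain P Z where PZ: "finite P" "\<forall>A\<in>P. arithmetic_progression A"
    "null_density Z" "S = \<Union>P \<union> Z"
    unfolding ap_union_mod_null_def by blast
  have "\<exists>A\<in>P. infinite A"
  proof (rule ccontr)
    assume "\<not> (\<exists>A\<in>P. infinite A)"
    then have "finite (\<Union>P)" using PZ(1) by blast
    then have "null_density S"
      unfolding PZ(4) by (intro null_density_Un null_density_finite PZ(3))
    with assms(2) show False by contradiction
  qed
  then obtain A where A: "A \<in> P" "infinite A" by blast
  with PZ(2) obtain a b where ab: "A = {a * n + b | n. True}"
    unfolding arithmetic_progression_def by blast
  have "a > 0"
  proof (rule ccontr)
    assume "\<not> a > 0"
    then have "A = {b}" using ab by simp
    with A(2) show False by simp
  qed
  moreover have "a * n + b \<in> S" for n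
    using A(1) ab PZ(4) by blast
  ultimately show thesis using that by blast
qed

section \<open>Families of subsets of the naturals with descending chain condition\<close>

text \<open>Models the return-time sets of closed sets: \<open>UNIV\<close> comes from the whole
  space, the shift from the preimage under the map, and well-foundedness from the Noetherian
  condition.\<close>

locale shift_noetherian =
  fixes C :: "nat set set"
  assumes UNIV_mem: "UNIV \<in> C"
    and Inter_mem: "\<And>F. F \<subseteq> C \<Longrightarrow> F \<noteq> {} \<Longrightarrow> \<Inter>F \<in> C"
    and shift_mem: "\<And>S. S \<in> C \<Longrightarrow> {n. n + 1 \<in> S} \<in> C"
    and wf_psubset: "wf {(S, T). S \<in> C \<and> T \<in> C \<and> S \<subset> T}"
begin

lemma Int_mem: "S \<in> C \<Longrightarrow> T \<in> C \<Longrightarrow> S \<inter> T \<in> C"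
  using Inter_mem[of "{S, T}"] by simp

lemma shift_mem_iterate: "S \<in> C \<Longrightarrow> {n. n + k \<in> S} \<in> C"
proof (induction k)
  case (Suc k)
  then show ?case using shift_mem[of "{n. n + k \<in> S}"] by simp
qed simp

definition cl :: "nat set \<Rightarrow> nat set" where
  "cl A = \<Inter>{S \<in> C. A \<subseteq> S}"

lemma cl_mem: "cl A \<in> C"
  unfolding cl_def by (rule Inter_mem) (use UNIV_mem in auto)

lemma subset_cl: "A \<subseteq> cl A"
  unfolding cl_def by blast

lemma cl_least: "S \<in> C \<Longrightarrow> A \<subseteq> S \<Longrightarrow> cl A \<subseteq> S"
  unfolding cl_def by blast

text \<open>For fixed \<open>a\<close> this is the set written E c in the introductory
  outline.\<close>

definition prog_cl :: "nat \<Rightarrow> nat \<Rightarrow> nat set" where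
  "prog_cl a c = cl (range (\<lambda>n. a * n + c))"

lemma prog_cl_mem: "prog_cl a c \<in> C"
  unfolding prog_cl_def by (rule cl_mem)

lemma prog_in_prog_cl: "a * n + c \<in> prog_cl a c"
  unfolding prog_cl_def by (rule subsetD[OF subset_cl rangeI])

lemma prog_cl_subset:
  assumes "S \<in> C" "\<And>n. a * n + c \<in> S"
  shows "prog_cl a c \<subseteq> S"
  unfolding prog_cl_def by (rule cl_least) (use assms in auto)

text \<open>Continuity of the shift: the pullback of \<open>prog_cl a (c + j)\<close> under adding
  \<open>j\<close> lies in \<open>C\<close> and contains the progression from \<open>c\<close>,
  hence also its closure.\<close>

lemma prog_cl_shift:
  assumes "s \<in> prog_cl a c"
  shows "s + j \<in> prog_cl a (c + j)"
proof -
  have "prog_cl a c \<subseteq> {n. n + j \<in> prog_cl a (c + j)}"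
    by (rule prog_cl_subset)
       (use prog_in_prog_cl[of a _ "c + j"] shift_mem_iterate prog_cl_mem in \<open>auto simp: add.assoc\<close>)
  with assms show ?thesis by blast
qed

lemma prog_cl_mono_shift:
  assumes "prog_cl a c \<subseteq> prog_cl a c'"
  shows "prog_cl a (c + j) \<subseteq> prog_cl a (c' + j)"
proof (rule prog_cl_subset[OF prog_cl_mem])
  fix n
  have "a * n + c \<in> prog_cl a c'"
    using assms prog_in_prog_cl by blast
  then show "a * n + (c + j) \<in> prog_cl a (c' + j)"
    using prog_cl_shift[of "a * n + c" a c' j] by (simp add: add.assoc)
qed

lemma prog_cl_iterate_shift:
  assumes "prog_cl a (i + d) \<subseteq> prog_cl a i"
  shows "prog_cl a (i + Suc n * d) \<subseteq> prog_cl a (i + d)"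
proof (induction n)
  case (Suc n)
  \<comment> \<open>The assumed inclusion translated by \<open>Suc n * d\<close> gives the next link
    of a descending chain.\<close>
  have "prog_cl a (i + d + Suc n * d) \<subseteq> prog_cl a (i + Suc n * d)"
    by (rule prog_cl_mono_shift[OF assms])
  with Suc show ?case by (simp add: add.assoc)
qed simp

lemma shift_invariant_if_between:
  assumes "S \<subseteq> prog_cl a i" "prog_cl a (i + d) \<subseteq> S" "a > 0" "s \<in> S"
  shows "s + a * d \<in> S"
proof -
  \<comment> \<open>As \<open>a > 0\<close>, the choice \<open>n = a - 1\<close> turns
    \<open>Suc n * d\<close> into \<open>a * d\<close>; the inclusion to be iterated is obtained by
    passing through \<open>S\<close>.\<close>
  have "prog_cl a (i + a * d) \<subseteq> prog_cl a (i + d)"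
    using prog_cl_iterate_shift[of a i d "a - 1"] assms(1-3) by simp
  moreover have "s + a * d \<in> prog_cl a (i + a * d)"
    using assms by (intro prog_cl_shift) blast
  ultimately show ?thesis using assms(2) by blast
qed

text \<open>The closures of the \<open>a\<close> residue classes cover the naturals. Either one of
  them contains \<open>S\<close>, which makes \<open>S\<close> shift invariant, or they cut
  \<open>S\<close> into finitely many proper subsets belonging to \<open>C\<close>.\<close>

lemma ap_union_mod_null_if_contains_progression:
  assumes "S \<in> C" "a > 0" and prog: "\<And>n. a * n + b \<in> S"
    and proper: "\<And>T. T \<in> C \<Longrightarrow> T \<subset> S \<Longrightarrow> ap_union_mod_null T"
  shows "ap_union_mod_null S"
proof (cases "\<exists>i<a. S \<subseteq> prog_cl a i")
  case True
  then obtain i where i: "i < a" "S \<subseteq> prog_cl a i" by blast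
  \<comment> \<open>Dropping the first term of the progression moves its offset from
    \<open>b\<close> to \<open>a + b\<close>, which exceeds \<open>i\<close>; hence
    \<open>d > 0\<close>.\<close>
  define d where "d = a + b - i"
  have d: "d > 0" "i + d = a + b"
    using i by (auto simp: d_def)
  have "a * n + (i + d) \<in> S" for n
    unfolding d(2) using prog[of "Suc n"] by (simp add: ac_simps)
  then have "prog_cl a (i + d) \<subseteq> S"
    by (intro prog_cl_subset \<open>S \<in> C\<close>)
  then show ?thesis
    using shift_invariant_if_between[OF i(2)] d(1) \<open>a > 0\<close>
    by (intro ap_union_mod_null_if_shift_invariant[of "a * d"]) auto
next
  case False
  have "ap_union_mod_null (S \<inter> prog_cl a i)" if "i < a" for i
    by (rule proper) (use False that in \<open>auto intro: Int_mem \<open>S \<in> C\<close> prog_cl_mem\<close>)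
  then have "ap_union_mod_null (\<Union>i\<in>{..<a}. S \<inter> prog_cl a i)"
    by (intro ap_union_mod_null_UN) auto
  moreover have "s mod a < a \<and> s \<in> prog_cl a (s mod a)" for s
    using prog_in_prog_cl[of a "s div a" "s mod a"] \<open>a > 0\<close> by simp
  then have "(\<Union>i\<in>{..<a}. S \<inter> prog_cl a i) = S"
    by blast
  ultimately show ?thesis by simp
qed

lemma mem_imp_ap_union_mod_null:
  assumes "S \<in> C"
  shows "ap_union_mod_null S"
  using wf_psubset assms
proof (induction S rule: wf_induct_rule)
  case (less S)
  then have IH: "ap_union_mod_null T" if "T \<in> C" "T \<subset> S" for T
    using that by auto
  show ?case
  proof (cases "null_density S")
    case True
    then show ?thesis by (rule null_density_imp_ap_union_mod_null)
  next
    case False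
    then obtain k where k: "k > 0" "\<not> null_density {n \<in> S. n + k \<in> S}"
      using null_density_if_returns_null by blast
    show ?thesis
    proof (cases "\<forall>s\<in>S. s + k \<in> S")
      case True
      then show ?thesis
        using ap_union_mod_null_if_shift_invariant k(1) by blast
    next
      case False
      \<comment> \<open>The return set is a proper member of the family, so induction applies to it;
        not being null, it then contains an infinite progression, which also lies in
        \<open>S\<close>.\<close>
      have "{n \<in> S. n + k \<in> S} = S \<inter> {n. n + k \<in> S}"
        by blast
      then have "{n \<in> S. n + k \<in> S} \<in> C"
        using Int_mem shift_mem_iterate less.prems by metis
      moreover have "{n \<in> S. n + k \<in> S} \<subset> S"
        using False by blast
      ultimately have "ap_union_mod_null {n \<in> S. n + k \<in> S}"
        by (rule IH)
      then obtain a b where "a > 0" "\<And>n. a * n + b \<in> {n \<in> S. n + k \<in> S}"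
        using k(2) ap_union_mod_null_contains_progression by blast
      then show ?thesis
        by (intro ap_union_mod_null_if_contains_progression[of S a b] less.prems IH) auto
    qed
  qed
qed

end

section \<open>Return times of an orbit to closed sets\<close>

lemma noetherian_space_wf_return_times:
  assumes "noetherian_space X"
  shows "wf {(S, T). (\<exists>Y. closedin X Y \<and> S = {n. f n \<in> Y}) \<and> (\<exists>Y. closedin X Y \<and> T = {n. f n \<in> Y}) \<and> S \<subset> T}"
  unfolding wf_iff_no_infinite_down_chain
proof
  assume "\<exists>S. \<forall>i. (S (Suc i), S i) \<in> {(S, T). (\<exists>Y. closedin X Y \<and> S = {n. f n \<in> Y}) \<and>
    (\<exists>Y. closedin X Y \<and> T = {n. f n \<in> Y}) \<and> S \<subset> T}"
  then obtain S where S: "\<And>i. \<exists>Y. closedin X Y \<and> S i = {n. f n \<in> Y}" "\<And>i. S (Suc i) \<subset> S i"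
    unfolding mem_Collect_eq prod.case by metis
  from S(1) obtain Y where Y: "\<And>i. closedin X (Y i)" "\<And>i. S i = {n. f n \<in> Y i}"
    by metis
  have "decseq S"
    by (rule decseq_SucI) (use S(2) in blast)
  \<comment> \<open>The chosen \<open>Y i\<close> need not be nested. Their finite intersections
    are, and they have the same return times because \<open>S\<close> is decreasing; strictness
    carries over since equal closed sets would have equal return times.\<close>
  define D where "D i = (\<Inter>j\<le>i. Y j)" for i
  have SD: "S i = {n. f n \<in> D i}" for i
  proof -
    have "S i \<subseteq> S j" if "j \<le> i" for j
      using \<open>decseq S\<close> that by (rule decseqD)
    then have "n \<in> S i \<longleftrightarrow> (\<forall>j\<le>i. n \<in> S j)" for n
      by blast
    moreover have "n \<in> S j \<longleftrightarrow> f n \<in> Y j" for n j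
      by (subst Y(2)) simp
    ultimately show ?thesis
      unfolding D_def by blast
  qed
  have "closedin X (D i)" for i
    unfolding D_def by (rule closedin_Inter) (use Y(1) in auto)
  moreover have "D (Suc i) \<subset> D i" for i
  proof -
    have "D (Suc i) \<subseteq> D i"
      by (auto simp: D_def)
    moreover have "D (Suc i) \<noteq> D i"
      using S(2)[of i] SD[of i] SD[of "Suc i"] by auto
    ultimately show ?thesis by blast
  qed
  ultimately show False
    using assms unfolding noetherian_space_def by blast
qed

text \<open>The preimage of \<open>Y\<close> is closed only relative to \<open>U\<close>, so it is
  the trace of some closed set of \<open>X\<close>. For an orbit staying in \<open>U\<close> that
  set is an adequate substitute.\<close>

lemma closedin_preimage_subtopology:
  assumes "continuous_map (subtopology X U) X \<Phi>" "closedin X Y" "U \<subseteq> topspace X"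
  obtains Y' where "closedin X Y'" "\<And>u. u \<in> U \<Longrightarrow> u \<in> Y' \<longleftrightarrow> \<Phi> u \<in> Y"
proof -
  have "closedin (subtopology X U) {u \<in> topspace (subtopology X U). \<Phi> u \<in> Y}"
    using assms by (intro closedin_continuous_map_preimage)
  then obtain Y' where "closedin X Y'" and Y': "{u \<in> topspace (subtopology X U). \<Phi> u \<in> Y} = Y' \<inter> U"
    unfolding closedin_subtopology by blast
  have "u \<in> Y' \<longleftrightarrow> \<Phi> u \<in> Y" if "u \<in> U" for u
  proof -
    have "u \<in> topspace (subtopology X U)"
      using that assms(3) by auto
    then show ?thesis using Y' that by blast
  qed
  with \<open>closedin X Y'\<close> show thesis by (rule that)
qed

theorem theorem3p2:
  fixes X :: "'a topology" and U Y :: "'a set" and \<Phi> :: "'a \<Rightarrow> 'a" and x :: 'a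
  assumes "noetherian_space X"
    and "openin X U"
    and "continuous_map (subtopology X U) X \<Phi>"
    and "x \<in> topspace X"
    and "\<And>n. (\<Phi> ^^ n) x \<in> U"
    and "closedin X Y"
  shows "\<exists>P Z. finite P \<and> (\<forall>A\<in>P. arithmetic_progression A) \<and> banach_density Z = 0 \<and>
           {n. (\<Phi> ^^ n) x \<in> Y} = \<Union>P \<union> Z"
proof -
  have U: "U \<subseteq> topspace X"
    using assms(2) by (rule openin_subset)
  define ret where "ret Y = {n. (\<Phi> ^^ n) x \<in> Y}" for Y
  interpret shift_noetherian "ret ` {Y. closedin X Y}"
  proof
    have "ret (topspace X) = UNIV"
      using U assms(5) by (auto simp: ret_def)
    then show "UNIV \<in> ret ` {Y. closedin X Y}"
      by (metis closedin_topspace imageI mem_Collect_eq)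
  next
    fix F assume F: "F \<subseteq> ret ` {Y. closedin X Y}" "F \<noteq> {}"
    then obtain G where G: "G \<subseteq> {Y. closedin X Y}" "F = ret ` G"
      by (auto simp: subset_image_iff)
    then have "\<Inter>F = ret (\<Inter>G)"
      by (auto simp: ret_def)
    moreover have "closedin X (\<Inter>G)"
      using F(2) G by (intro closedin_Inter) auto
    ultimately show "\<Inter>F \<in> ret ` {Y. closedin X Y}"
      by blast
  next
    fix S assume "S \<in> ret ` {Y. closedin X Y}"
    then obtain W where W: "closedin X W" "S = ret W"
      by blast
    obtain W' where W': "closedin X W'" "\<And>u. u \<in> U \<Longrightarrow> u \<in> W' \<longleftrightarrow> \<Phi> u \<in> W"
      using closedin_preimage_subtopology[OF assms(3) W(1) U] by blast
    \<comment> \<open>The iterate n + 1 is \<Phi> applied to the iterate n, which lies in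
      \<open>U\<close>, where membership in \<open>W'\<close> decides whether the image is in
      \<open>W\<close>.\<close>
    have "{n. n + 1 \<in> S} = ret W'"
      using W'(2) assms(5) by (auto simp: W(2) ret_def)
    with W'(1) show "{n. n + 1 \<in> S} \<in> ret ` {Y. closedin X Y}"
      by blast
  next
    show "wf {(S, T). S \<in> ret ` {Y. closedin X Y} \<and> T \<in> ret ` {Y. closedin X Y} \<and> S \<subset> T}"
      by (rule wf_subset[OF noetherian_space_wf_return_times[OF assms(1), of "\<lambda>n. (\<Phi> ^^ n) x"]])
         (auto simp: ret_def)
  qed
  have "ap_union_mod_null {n. (\<Phi> ^^ n) x \<in> Y}"
    by (rule mem_imp_ap_union_mod_null) (use assms(6) in \<open>auto simp: ret_def\<close>)
  then show ?thesis
    unfolding ap_union_mod_null_def using null_density_imp_banach_density by blast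
qed

end
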